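(* Let $m=2$ and $a=2^\ell/n$ with $\ell\in\mathbb{N}_0=\{0,1,2,\dots\}$ and $n\in\mathbb{N}=\{1,2,\dots\}$, and let $K_{2^\ell/n}^2$ be the corresponding radially deformed Fourier kernel (see context). There exists $C>0$ depending only on $a$ such that $$\left|K_{\frac{2^\ell}{n}}^2(x,y)\right|\le C\qquad\text{for all }x,y\in\mathbb{R}^2.$$
   Context: For $a>0$ and $x,y\in\mathbb{R}^2\setminus\{0\}$ put $z=|x||y|$ and $\langle x,y\rangle=z\cos\theta$, $\theta\in[0,\pi]$. The two-dimensional radially deformed Fourier kernel is $$K_a^2(x,y)=J_0(z_a)+2\sum_{k=1}^{\infty}e^{-\frac{i\pi k}{a}}J_{\frac{2k}{a}}(z_a)\cos k\theta,\qquad z_a=\frac2a z^{a/2},$$ where $J_\nu$ is the Bessel function of the first kind. If $x=0$ or $y=0$ the kernel is defined by continuity and equals $1$. *)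

theory Defs
  imports "HOL-Analysis.Analysis"
begin

text \<open>Bessel function of the first kind, for real order and argument \<open>z \<ge> 0\<close>, by its power series
  \<open>\<Sum>j. (-1)^j / (j! \<Gamma>(j + \<nu> + 1)) (z/2)^(2 j + \<nu>)\<close>.
  The case distinction is needed because \<open>0 powr 0 = 0\<close>, whereas \<open>J\<^sub>0(0) = 1\<close>.\<close>

definition bessel_J :: "real \<Rightarrow> real \<Rightarrow> real" where
  "bessel_J \<nu> z = (if \<nu> = 0 then 1 else (z / 2) powr \<nu>) *
     (\<Sum>j. (-1) ^ j / (fact j * Gamma (real j + \<nu> + 1)) * (z / 2) ^ (2 * j))"

text \<open>The angle in \<open>[0, \<pi>]\<close> between two nonzero vectors.\<close>

definition angle :: "real ^ 2 \<Rightarrow> real ^ 2 \<Rightarrow> real" where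
  "angle x y = arccos ((x \<bullet> y) / (norm x * norm y))"

text \<open>The two-dimensional radially deformed Fourier kernel, for \<open>a > 0\<close>. The series over
  \<open>k \<ge> 1\<close> is written with \<open>Suc k\<close>; the value \<open>1\<close> at \<open>x = 0\<close> or \<open>y = 0\<close> is the continuous
  extension.\<close>

definition deformed_kernel :: "real \<Rightarrow> real ^ 2 \<Rightarrow> real ^ 2 \<Rightarrow> complex" where
  "deformed_kernel a x y =
     (if x = 0 \<or> y = 0 then 1
      else let z = norm x * norm y; \<theta> = angle x y; za = 2 / a * z powr (a / 2) in
        of_real (bessel_J 0 za) +
        2 * (\<Sum>k. exp (- (\<i> * of_real pi * of_nat (Suc k) / of_real a)) *
                  of_real (bessel_J (2 * real (Suc k) / a) za * cos (real (Suc k) * \<theta>))))"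

end

theory Submission
  imports Defs
begin

text \<open>Since \<open>a\<close> is rational, the orders \<open>2k/a\<close> in the kernel form an arithmetic progression with a rational step
\<open>p/q\<close>. Splitting the cosine into two exponentials and absorbing \<open>exp(-\<i>\<pi>k/a)\<close> into their phases, it suffices
to bound \<open>\<Sum>k. J\<^bsub>kp/q\<^esub>(w) exp(\<i>k\<eta>)\<close> uniformly in \<open>w > 0\<close> and real \<open>\<eta>\<close>. Averaging over \<open>p\<close>-th roots of unity
(\<open>norm_phase_subseries_le\<close>) extracts this series from the one with all orders \<open>m/q\<close>, and sorting \<open>m\<close> by its
residue modulo \<open>q\<close> (\<open>norm_phase_series_le_residue_classes\<close>) reduces the problem to the one-sided series
\<open>h(w) = \<Sum>j. J\<^bsub>\<mu>+j\<^esub>(w) exp(\<i>j\<psi>)\<close> with \<open>0 \<le> \<mu> < 1\<close>, which is the heart of the matter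
(\<open>one_sided_bessel_series_bounded\<close>).

From \<open>2 J\<^sub>\<nu>' = J\<^bsub>\<nu>-1\<^esub> - J\<^bsub>\<nu>+1\<^esub>\<close> one obtains the first order equation
\<open>h' = \<i> sin \<psi> h + (J\<^bsub>\<mu>-1\<^esub> + exp(-\<i>\<psi>) J\<^sub>\<mu>) / 2\<close>. Its driving term is only of size \<open>1 / sqrt u\<close>
(\<open>bessel_pair_decay\<close>), so boundedness of \<open>h\<close> is a matter of oscillation. The driving term consists of one part
of frequency \<open>1\<close> and one of frequency \<open>-1\<close>, and resonance with \<open>exp(\<i> u sin \<psi>)\<close> occurs as \<open>sin \<psi>\<close> approaches
\<open>1\<close> or \<open>-1\<close>. The resonant part then has a coefficient proportional to \<open>sqrt d\<close>, where \<open>d\<close> is the distance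
between the frequencies (\<open>bessel_phase_decomposition\<close>), while the oscillatory integral of
\<open>exp(\<i>du) / sqrt u\<close> is of size \<open>1 / sqrt d\<close>. The two effects cancel, and
\<open>corrected_oscillatory_primitive\<close> makes this quantitative with bounds uniform in \<open>d\<close>.\<close>

section \<open>Bessel functions of real order\<close>

text \<open>The factor left of \<open>J\<^sub>\<nu>(z)\<close> after \<open>(z/2)\<^sup>\<nu>\<close> is removed, as a function of \<open>t = (z/2)\<^sup>2\<close>; it is an entire
function of \<open>t\<close>. The reciprocal Gamma function keeps the coefficients meaningful when \<open>\<nu> = -1\<close>, where the
term \<open>j = 0\<close> sits at a pole of Gamma and vanishes.\<close>

definition bessel_entire :: "real \<Rightarrow> real \<Rightarrow> real" where
  "bessel_entire \<nu> t = (\<Sum>j. (-1) ^ j * rGamma (\<nu> + 1 + real j) / fact j * t ^ j)"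

text \<open>From \<open>x \<ge> 1\<close> on, each application of the functional equation \<open>\<Gamma>(y + 1) = y \<Gamma>(y)\<close> multiplies Gamma by at
least the next natural number.\<close>

lemma rGamma_shift_bound:
  fixes x :: real
  assumes "x \<ge> 1"
  shows "0 < rGamma (x + real k)" "rGamma (x + real k) \<le> rGamma x / fact k"
proof -
  show pos: "0 < rGamma (x + real k)" for k
    using assms by (simp add: rGamma_inverse_Gamma Gamma_real_pos)
  show "rGamma (x + real k) \<le> rGamma x / fact k"
  proof (induction k)
    case (Suc k)
    have "(real k + 1) * rGamma (x + real (Suc k)) \<le> (x + real k) * rGamma (x + real (Suc k))"
      using assms pos[of "Suc k"] by (intro mult_right_mono) auto
    also have "\<dots> = rGamma (x + real k)"
      using rGamma_plus1[of "x + real k"] by (simp add: add_ac)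
    also note Suc.IH
    finally have "rGamma (x + real (Suc k)) \<le> rGamma x / fact k / (real k + 1)"
      by (subst pos_le_divide_eq) (simp_all add: mult.commute[of _ "real k + 1"] del: of_nat_Suc)
    moreover have "fact (Suc k) = fact k * (real k + 1)" by (simp add: algebra_simps)
    ultimately show ?case by (simp only: divide_divide_eq_left)
  qed simp
qed

lemma summable_bessel_entire:
  assumes "\<nu> \<ge> -1"
  shows "summable (\<lambda>j. (-1) ^ j * rGamma (\<nu> + 1 + real j) / fact j * t ^ j)"
proof (rule summable_comparison_test')
  show "summable (\<lambda>j. rGamma (\<nu> + 2) * (inverse (fact j) * \<bar>t\<bar> ^ j))"
    by (intro summable_mult summable_exp)
next
  fix j :: nat assume "j \<ge> 1"
  then obtain k where k: "j = Suc k" by (cases j) auto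
  have b: "0 < rGamma (\<nu> + 2 + real k)" "rGamma (\<nu> + 2 + real k) \<le> rGamma (\<nu> + 2) / fact k"
    using rGamma_shift_bound[of "\<nu> + 2" k] assms by auto
  have "rGamma (\<nu> + 2) / fact k \<le> rGamma (\<nu> + 2) / 1"
    using rGamma_shift_bound(1)[of "\<nu> + 2" 0] assms by (intro divide_left_mono) auto
  then have "\<bar>rGamma (\<nu> + 1 + real j)\<bar> \<le> rGamma (\<nu> + 2)"
    using b by (simp add: k add_ac)
  then show "norm ((-1) ^ j * rGamma (\<nu> + 1 + real j) / fact j * t ^ j)
      \<le> rGamma (\<nu> + 2) * (inverse (fact j) * \<bar>t\<bar> ^ j)"
    by (simp add: abs_mult power_abs divide_simps mult_right_mono)
qed

lemma bessel_entire_deriv: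
  assumes "\<nu> \<ge> -1"
  shows "(bessel_entire \<nu> has_real_derivative - bessel_entire (\<nu> + 1) t) (at t)"
proof -
  let ?c = "\<lambda>\<nu> j. (-1) ^ j * rGamma (\<nu> + 1 + real j) / fact j :: real"
  have "((\<lambda>t. \<Sum>j. ?c \<nu> j * t ^ j) has_real_derivative (\<Sum>j. diffs (?c \<nu>) j * t ^ j)) (at t)"
    by (rule termdiffs_strong_converges_everywhere) (rule summable_bessel_entire[OF assms])
  moreover have "diffs (?c \<nu>) = (\<lambda>j. - ?c (\<nu> + 1) j)"
    by (rule ext) (simp add: diffs_def divide_simps add_ac)
  moreover have "(\<Sum>j. - ?c (\<nu> + 1) j * t ^ j) = - bessel_entire (\<nu> + 1) t"
    using suminf_minus[OF summable_bessel_entire[of "\<nu> + 1" t]] assms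
    by (simp add: bessel_entire_def)
  ultimately show ?thesis unfolding bessel_entire_def[abs_def] by simp
qed

text \<open>The coefficient on the left is \<open>(\<nu> + j)\<close> times the one of \<open>bessel_entire \<nu>\<close>; the part with \<open>\<nu>\<close> gives the
first term, and the part with \<open>j\<close> cancels against the factorial and shifts the series by one.\<close>

lemma bessel_entire_recurrence:
  assumes "\<nu> \<ge> 0"
  shows "bessel_entire (\<nu> - 1) t = \<nu> * bessel_entire \<nu> t - t * bessel_entire (\<nu> + 1) t"
proof -
  let ?c = "\<lambda>\<nu> j. (-1) ^ j * rGamma (\<nu> + 1 + real j) / fact j * t ^ j :: real"
  have s: "?c \<kappa> sums bessel_entire \<kappa> t" if "\<kappa> \<ge> -1" for \<kappa>
    unfolding bessel_entire_def using summable_bessel_entire[OF that] by (rule summable_sums)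
  have "(\<lambda>j. - t * ?c (\<nu> + 1) j) sums (- t * bessel_entire (\<nu> + 1) t)"
    by (intro sums_mult s) (use assms in auto)
  then have "(\<lambda>j. real (Suc j) * ?c \<nu> (Suc j)) sums (- t * bessel_entire (\<nu> + 1) t)"
    by (rule sums_cong[THEN iffD1, rotated]) (simp add: divide_simps add_ac)
  then have "(\<lambda>j. real j * ?c \<nu> j) sums (- t * bessel_entire (\<nu> + 1) t)"
    by (subst (asm) sums_Suc_iff) simp
  then have "(\<lambda>j. \<nu> * ?c \<nu> j + real j * ?c \<nu> j)
      sums (\<nu> * bessel_entire \<nu> t + - t * bessel_entire (\<nu> + 1) t)"
    by (intro sums_add sums_mult s) (use assms in auto)
  moreover have "\<nu> * ?c \<nu> j + real j * ?c \<nu> j = ?c (\<nu> - 1) j" for j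
  proof -
    have "?c (\<nu> - 1) j = (-1) ^ j * ((\<nu> + real j) * rGamma (\<nu> + real j + 1)) / fact j * t ^ j"
      using rGamma_plus1[of "\<nu> + real j"] by simp
    then show ?thesis by (simp add: algebra_simps add_divide_distrib)
  qed
  ultimately have "?c (\<nu> - 1) sums (\<nu> * bessel_entire \<nu> t + - t * bessel_entire (\<nu> + 1) t)"
    by simp
  with s[of "\<nu> - 1"] show ?thesis using assms sums_unique2 by fastforce
qed

text \<open>The factorial in the order makes series over the orders \<open>\<mu>, \<mu> + 1, \<dots>\<close> converge as fast as an exponential
series.\<close>

lemma bessel_entire_bound:
  assumes "\<mu> \<ge> 0"
  shows "\<bar>bessel_entire (\<mu> + real k) t\<bar> \<le> rGamma (\<mu> + 1) * exp \<bar>t\<bar> / fact k"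
proof -
  let ?c = "\<lambda>j. (-1) ^ j * rGamma (\<mu> + real k + 1 + real j) / fact j * t ^ j :: real"
  let ?d = "\<lambda>j. rGamma (\<mu> + 1) / fact k * (inverse (fact j) * \<bar>t\<bar> ^ j)"
  have d: "?d sums (rGamma (\<mu> + 1) / fact k * exp \<bar>t\<bar>)"
    by (intro sums_mult) (use exp_converges[of "\<bar>t\<bar>"] in \<open>simp add: scaleR_conv_of_real\<close>)
  have le: "norm (?c j) \<le> ?d j" for j
  proof -
    have b: "0 < rGamma (\<mu> + 1 + real k + real j)"
      "rGamma (\<mu> + 1 + real k + real j) \<le> rGamma (\<mu> + 1 + real k) / fact j"
      using rGamma_shift_bound[of "\<mu> + 1 + real k" j] assms by auto
    have "rGamma (\<mu> + 1 + real k) / fact j \<le> rGamma (\<mu> + 1 + real k) / 1"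
      using rGamma_shift_bound(1)[of "\<mu> + 1" k] assms by (intro divide_left_mono) auto
    also have "\<dots> \<le> rGamma (\<mu> + 1) / fact k"
      using rGamma_shift_bound(2)[of "\<mu> + 1" k] assms by simp
    finally have "\<bar>rGamma (\<mu> + real k + 1 + real j)\<bar> \<le> rGamma (\<mu> + 1) / fact k"
      using b by (simp add: add_ac)
    then have "\<bar>rGamma (\<mu> + real k + 1 + real j)\<bar> * (inverse (fact j) * \<bar>t\<bar> ^ j) \<le> ?d j"
      by (intro mult_right_mono) auto
    then show ?thesis by (simp add: abs_mult power_abs divide_simps)
  qed
  have "norm (suminf ?c) \<le> suminf ?d"
    by (rule norm_suminf_le) (use le sums_summable[OF d] in simp_all)
  then show ?thesis using sums_unique[OF d] by (simp add: bessel_entire_def)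
qed

lemma bessel_J_eq:
  assumes "z > 0"
  shows "bessel_J \<nu> z = (z / 2) powr \<nu> * bessel_entire \<nu> ((z / 2)\<^sup>2)"
proof -
  have "(z / 2) ^ (2 * j) = ((z / 2)\<^sup>2) ^ j" for j by (rule power_mult)
  then have "(-1) ^ j / (fact j * Gamma (real j + \<nu> + 1)) * (z / 2) ^ (2 * j)
      = (-1) ^ j * rGamma (\<nu> + 1 + real j) / fact j * ((z / 2)\<^sup>2) ^ j" for j
    by (simp only: rGamma_inverse_Gamma divide_inverse inverse_mult_distrib add_ac mult_ac)
  then show ?thesis using assms by (simp add: bessel_J_def bessel_entire_def)
qed

lemma bessel_J_deriv:
  assumes "\<nu> \<ge> -1" "z > 0"
  shows "(bessel_J \<nu> has_real_derivative \<nu> / z * bessel_J \<nu> z - bessel_J (\<nu> + 1) z) (at z)"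
proof -
  have half: "((\<lambda>z. z / 2) has_real_derivative 1 / 2) (at z)"
    by (auto intro!: derivative_eq_intros)
  have half_sq: "((\<lambda>z. (z / 2)\<^sup>2) has_real_derivative z / 2) (at z)"
    by (auto intro!: derivative_eq_intros)
  have pw: "((\<lambda>z. (z / 2) powr \<nu>) has_real_derivative \<nu> * (z / 2) powr (\<nu> - 1) * (1 / 2)) (at z)"
    by (rule DERIV_chain2[where f = "\<lambda>z. z powr \<nu>", OF has_real_derivative_powr half])
       (use assms in simp)
  have split: "\<nu> * (z / 2) powr (\<nu> - 1) * (1 / 2) = \<nu> / z * (z / 2) powr \<nu>"
    "(z / 2) powr (\<nu> + 1) = (z / 2) powr \<nu> * (z / 2)"
    using assms by (simp_all add: powr_diff powr_add)
  have "((\<lambda>z. (z / 2) powr \<nu> * bessel_entire \<nu> ((z / 2)\<^sup>2)) has_real_derivative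
      \<nu> * (z / 2) powr (\<nu> - 1) * (1 / 2) * bessel_entire \<nu> ((z / 2)\<^sup>2)
      + - bessel_entire (\<nu> + 1) ((z / 2)\<^sup>2) * (z / 2) * (z / 2) powr \<nu>) (at z)"
    by (rule DERIV_mult[OF pw DERIV_chain2[OF bessel_entire_deriv[OF assms(1)] half_sq]])
  also have "\<nu> * (z / 2) powr (\<nu> - 1) * (1 / 2) * bessel_entire \<nu> ((z / 2)\<^sup>2)
      + - bessel_entire (\<nu> + 1) ((z / 2)\<^sup>2) * (z / 2) * (z / 2) powr \<nu>
      = \<nu> / z * bessel_J \<nu> z - bessel_J (\<nu> + 1) z"
    unfolding bessel_J_eq[OF assms(2)] split by (simp add: mult_ac)
  finally show ?thesis
    by (rule has_field_derivative_transform_within_open[where S = "{0<..}"])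
       (use assms in \<open>simp_all add: bessel_J_eq\<close>)
qed

lemma bessel_J_recurrence:
  assumes "\<nu> \<ge> 0" "z > 0"
  shows "bessel_J (\<nu> - 1) z = 2 * \<nu> / z * bessel_J \<nu> z - bessel_J (\<nu> + 1) z"
proof -
  have p: "(z / 2) powr (\<nu> - 1) = (z / 2) powr \<nu> / (z / 2)"
    "(z / 2) powr (\<nu> + 1) = (z / 2) powr \<nu> * (z / 2)"
    using assms by (simp_all add: powr_diff powr_add)
  have "X / (z / 2) * (\<nu> * E - (z / 2)\<^sup>2 * E') = 2 * \<nu> / z * (X * E) - X * (z / 2) * E'"
    for X E E' using assms by (simp add: field_simps power2_eq_square)
  then show ?thesis
    unfolding bessel_J_eq[OF assms(2)] bessel_entire_recurrence[OF assms(1)] p by this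
qed

lemma bessel_J_deriv_lower:
  assumes "\<nu> \<ge> 0" "z > 0"
  shows "(bessel_J \<nu> has_real_derivative bessel_J (\<nu> - 1) z - \<nu> / z * bessel_J \<nu> z) (at z)"
  using bessel_J_deriv[of \<nu> z] bessel_J_recurrence[of \<nu> z] assms by simp

lemma bessel_J_deriv_symmetric:
  assumes "\<nu> \<ge> 0" "z > 0"
  shows "(bessel_J \<nu> has_real_derivative (bessel_J (\<nu> - 1) z - bessel_J (\<nu> + 1) z) / 2) (at z)"
proof -
  have "\<nu> / z * bessel_J \<nu> z - bessel_J (\<nu> + 1) z = (bessel_J (\<nu> - 1) z - bessel_J (\<nu> + 1) z) / 2"
    using bessel_J_recurrence[OF assms] by simp
  moreover have "(bessel_J \<nu> has_real_derivative \<nu> / z * bessel_J \<nu> z - bessel_J (\<nu> + 1) z) (at z)"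
    using bessel_J_deriv assms by simp
  ultimately show ?thesis by (simp only:)
qed

text \<open>The bound is uniform in \<open>z\<close> on \<open>(0, w]\<close>, so that the orders far out are negligible on the whole interval.\<close>

lemma bessel_J_bound:
  assumes "\<mu> \<ge> 0" "z > 0" "z \<le> w"
  shows "\<bar>bessel_J (\<mu> + real k) z\<bar>
    \<le> rGamma (\<mu> + 1) * exp ((w / 2)\<^sup>2) * (w / 2) powr \<mu> * (inverse (fact k) * (w / 2) ^ k)"
proof -
  have g: "rGamma (\<mu> + 1) > 0" using rGamma_shift_bound(1)[of "\<mu> + 1" 0] assms by simp
  have "\<bar>bessel_entire (\<mu> + real k) ((z / 2)\<^sup>2)\<bar> \<le> rGamma (\<mu> + 1) * exp ((z / 2)\<^sup>2) / fact k"
    using bessel_entire_bound[of \<mu> k "(z / 2)\<^sup>2"] assms by simp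
  also have "\<dots> \<le> rGamma (\<mu> + 1) * exp ((w / 2)\<^sup>2) / fact k"
  proof -
    have "(z / 2)\<^sup>2 \<le> (w / 2)\<^sup>2" using assms by (intro power_mono) auto
    then show ?thesis using g by (intro divide_right_mono mult_left_mono) auto
  qed
  finally have e: "\<bar>bessel_entire (\<mu> + real k) ((z / 2)\<^sup>2)\<bar> \<le> \<dots>" .
  have "(z / 2) powr (\<mu> + real k) \<le> (w / 2) powr (\<mu> + real k)"
    using assms by (intro powr_mono2) auto
  also have "\<dots> = (w / 2) powr \<mu> * (w / 2) ^ k"
    using assms by (simp add: powr_add powr_realpow)
  finally have "(z / 2) powr (\<mu> + real k) * \<bar>bessel_entire (\<mu> + real k) ((z / 2)\<^sup>2)\<bar>
      \<le> ((w / 2) powr \<mu> * (w / 2) ^ k) * (rGamma (\<mu> + 1) * exp ((w / 2)\<^sup>2) / fact k)"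
    using e assms by (intro mult_mono) auto
  then have "\<bar>bessel_J (\<mu> + real k) z\<bar>
      \<le> ((w / 2) powr \<mu> * (w / 2) ^ k) * (rGamma (\<mu> + 1) * exp ((w / 2)\<^sup>2) / fact k)"
    using assms by (simp add: bessel_J_eq abs_mult)
  then show ?thesis by (simp only: divide_inverse mult_ac)
qed

section \<open>Decay of consecutive Bessel functions\<close>

text \<open>An energy argument. With \<open>A = J\<^bsub>\<mu>-1\<^esub>\<close> and \<open>B = J\<^sub>\<mu>\<close> the recurrences give
\<open>(u (A\<^sup>2 + B\<^sup>2))' = (2\<mu> - 1) (A\<^sup>2 - B\<^sup>2)\<close>, which is not small enough, but \<open>(A B)' = A\<^sup>2 - B\<^sup>2 - A B / u\<close>. Hence
the corrected energy \<open>E = u (A\<^sup>2 + B\<^sup>2) - (2\<mu> - 1) A B\<close> satisfies \<open>E' = (2\<mu> - 1) A B / u \<le> E / u\<^sup>2\<close>, which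
means that \<open>exp(1/u) E(u)\<close> does not increase, and for \<open>u \<ge> 1\<close> the correction is at most half of the main
term.\<close>

lemma bessel_pair_decay:
  assumes "0 \<le> \<mu>" "\<mu> < 1"
  obtains K where "K \<ge> 0"
    "\<And>u. u \<ge> 1 \<Longrightarrow> u * ((bessel_J (\<mu> - 1) u)\<^sup>2 + (bessel_J \<mu> u)\<^sup>2) \<le> K"
proof -
  let ?A = "bessel_J (\<mu> - 1)" and ?B = "bessel_J \<mu>" and ?c = "2 * \<mu> - 1"
  define E where "E u = u * ((?A u)\<^sup>2 + (?B u)\<^sup>2) - ?c * (?A u * ?B u)" for u
  have cross: "\<bar>?c * (?A u * ?B u)\<bar> \<le> ((?A u)\<^sup>2 + (?B u)\<^sup>2) / 2" for u
  proof -
    have "2 * \<bar>?A u\<bar> * \<bar>?B u\<bar> \<le> \<bar>?A u\<bar>\<^sup>2 + \<bar>?B u\<bar>\<^sup>2" by (rule sum_squares_bound)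
    then have "\<bar>?A u * ?B u\<bar> \<le> ((?A u)\<^sup>2 + (?B u)\<^sup>2) / 2" by (simp add: abs_mult)
    moreover have "\<bar>?c\<bar> * \<bar>?A u * ?B u\<bar> \<le> 1 * \<bar>?A u * ?B u\<bar>"
      using assms by (intro mult_right_mono) auto
    ultimately show ?thesis by (simp only: abs_mult[of ?c])
  qed
  have coercive: "u * ((?A u)\<^sup>2 + (?B u)\<^sup>2) \<le> 2 * E u" if "u \<ge> 1" for u
  proof -
    have "(?A u)\<^sup>2 + (?B u)\<^sup>2 \<le> u * ((?A u)\<^sup>2 + (?B u)\<^sup>2)"
      using mult_right_mono[OF that, of "(?A u)\<^sup>2 + (?B u)\<^sup>2"] by simp
    then show ?thesis using cross[of u] by (simp add: E_def)
  qed
  have deriv: "((\<lambda>u. exp (1 / u) * E u) has_real_derivative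
      exp (1 / u) * (?c * (?A u * ?B u) / u - E u / u\<^sup>2)) (at u)" if "u \<ge> 1" for u
  proof -
    have "(?A has_real_derivative (\<mu> - 1) / u * ?A u - ?B u) (at u)"
      using bessel_J_deriv[of "\<mu> - 1" u] that assms by simp
    moreover have "(?B has_real_derivative ?A u - \<mu> / u * ?B u) (at u)"
      using bessel_J_deriv_lower[of \<mu> u] that assms by simp
    moreover have "(E has_real_derivative 1 * ((?A u)\<^sup>2 + (?B u)\<^sup>2)
        + u * (2 * ?A u * a' + 2 * ?B u * b') - ?c * (a' * ?B u + ?A u * b')) (at u)"
      if "(?A has_real_derivative a') (at u)" "(?B has_real_derivative b') (at u)" for a' b'
      unfolding E_def using that by (auto intro!: derivative_eq_intros simp: algebra_simps)
    ultimately have "(E has_real_derivative 1 * ((?A u)\<^sup>2 + (?B u)\<^sup>2)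
        + u * (2 * ?A u * ((\<mu> - 1) / u * ?A u - ?B u) + 2 * ?B u * (?A u - \<mu> / u * ?B u))
        - ?c * (((\<mu> - 1) / u * ?A u - ?B u) * ?B u + ?A u * (?A u - \<mu> / u * ?B u))) (at u)"
      by blast
    moreover have "1 * (a\<^sup>2 + b\<^sup>2)
        + u * (2 * a * ((\<mu> - 1) / u * a - b) + 2 * b * (a - \<mu> / u * b))
        - ?c * (((\<mu> - 1) / u * a - b) * b + a * (a - \<mu> / u * b)) = ?c * (a * b) / u" for a b
      using that by (simp add: field_simps power2_eq_square)
    ultimately have "(E has_real_derivative ?c * (?A u * ?B u) / u) (at u)" by simp
    moreover have "((\<lambda>u. exp (1 / u)) has_real_derivative exp (1 / u) * (- 1 / u\<^sup>2)) (at u)"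
      using that by (auto intro!: derivative_eq_intros simp: power2_eq_square)
    ultimately show ?thesis
      by (intro DERIV_cong[OF DERIV_mult]) (assumption, assumption, simp add: algebra_simps)
  qed
  have "u * ((?A u)\<^sup>2 + (?B u)\<^sup>2) \<le> 2 * (exp 1 * E 1)" if u: "u \<ge> 1" for u
  proof -
    have "exp (1 / u) * E u \<le> exp (1 / 1) * E 1"
    proof (rule DERIV_nonpos_imp_nonincreasing[OF u], intro exI conjI)
      fix v assume v: "1 \<le> v" "v \<le> u"
      show "((\<lambda>u. exp (1 / u) * E u) has_real_derivative
          exp (1 / v) * (?c * (?A v * ?B v) / v - E v / v\<^sup>2)) (at v)"
        by (rule deriv[OF v(1)])
      have "v * (?c * (?A v * ?B v)) \<le> v * (((?A v)\<^sup>2 + (?B v)\<^sup>2) / 2)"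
        using cross[of v] v by (intro mult_left_mono) auto
      also have "\<dots> \<le> E v" using coercive[OF v(1)] by simp
      finally have "v * (?c * (?A v * ?B v)) / v\<^sup>2 \<le> E v / v\<^sup>2"
        by (rule divide_right_mono) simp
      then have "?c * (?A v * ?B v) / v \<le> E v / v\<^sup>2"
        using v by (simp add: power2_eq_square)
      then show "exp (1 / v) * (?c * (?A v * ?B v) / v - E v / v\<^sup>2) \<le> 0"
        by (simp add: mult_le_0_iff)
    qed
    moreover have "0 \<le> E u"
      using coercive[OF u] u by (smt (verit) mult_nonneg_nonneg zero_le_power2)
    then have "E u \<le> exp (1 / u) * E u"
      using u by (simp add: mult_le_cancel_right1)
    ultimately show ?thesis using coercive[OF u] by simp
  qed
  moreover from this[of 1] have "0 \<le> 2 * (exp 1 * E 1)"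
    by (smt (verit) zero_le_power2)
  ultimately show thesis using that by blast
qed

section \<open>An approximate primitive near resonance\<close>

text \<open>The function \<open>R\<close> oscillates like \<open>exp(\<i>\<sigma>u) / sqrt u\<close>, so the integrand \<open>c exp(-\<i>su) R(u)\<close> has frequency
\<open>d = \<sigma> - s\<close> and its integral is of size \<open>\<bar>c\<bar> / sqrt \<bar>d\<bar>\<close>. This stays bounded as \<open>d\<close> tends to \<open>0\<close> exactly because
\<open>\<bar>c\<bar>\<close> vanishes like \<open>sqrt \<bar>d\<bar>\<close>.

Integration by parts would divide by \<open>\<i>d\<close>, which is only good for \<open>u > 1/\<bar>d\<bar>\<close>. Dividing by \<open>\<i>d + 1/u\<close> instead
handles all \<open>u \<ge> 1\<close> at once: the resulting \<open>F\<close> is bounded, and the error \<open>e\<close> has a bound whose integral over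
\<open>[1, \<infinity>)\<close> is finite uniformly in \<open>d\<close>.\<close>

lemma corrected_oscillatory_primitive:
  fixes R :: "real \<Rightarrow> complex" and c :: complex and \<sigma> s \<beta> K :: real
  assumes R: "\<And>u. u \<ge> 1 \<Longrightarrow>
      (R has_vector_derivative \<i> * of_real \<sigma> * R u + (of_real \<beta> * cnj (R u) - R u / 2) / of_real u) (at u)"
    and decay: "\<And>u. u \<ge> 1 \<Longrightarrow> u * (norm (R u))\<^sup>2 \<le> K"
    and \<beta>: "\<bar>\<beta>\<bar> \<le> 1 / 2"
    and c: "(norm c)\<^sup>2 = \<bar>\<sigma> - s\<bar> / 2"
  obtains F e where
    "\<And>u. u \<ge> 1 \<Longrightarrow> (F has_vector_derivative c * exp (- \<i> * of_real s * of_real u) * R u + e u) (at u)"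
    "\<And>u. u \<ge> 1 \<Longrightarrow> norm (F u) \<le> sqrt K / 2"
    "\<And>u. u \<ge> 1 \<Longrightarrow> norm (e u) \<le> 3 * sqrt K * (sqrt \<bar>\<sigma> - s\<bar> / (sqrt u * (1 + \<bar>\<sigma> - s\<bar> * u)))"
proof -
  define d where "d = \<sigma> - s"
  define D where "D u = 1 + \<i> * of_real d * of_real u" for u :: real
  define F where "F u = c * exp (- \<i> * of_real s * of_real u) * R u * (of_real u / D u)" for u
  define e where "e u = c * exp (- \<i> * of_real s * of_real u) *
     (R u / (D u)\<^sup>2 + (of_real \<beta> * cnj (R u) - R u * (3 / 2)) / D u)" for u
  have D0: "D u \<noteq> 0" for u by (simp add: D_def complex_eq_iff)
  have Dsq: "(norm (D u))\<^sup>2 = 1 + (d * u)\<^sup>2" for u by (simp add: D_def cmod_power2)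
  have Rn: "norm (R u) \<le> sqrt K / sqrt u" if "u \<ge> 1" for u
  proof -
    have "(norm (R u))\<^sup>2 \<le> K / u" using decay[OF that] that by (simp add: field_simps)
    from real_le_rsqrt[OF this] show ?thesis by (simp add: real_sqrt_divide)
  qed
  have cn: "norm c = sqrt (\<bar>d\<bar> / 2)"
    using c by (metis d_def norm_ge_zero real_sqrt_unique)
  have En: "norm (exp (- \<i> * of_real s * of_real u)) = 1" for u
    by (simp add: norm_exp_eq_Re)
  have "(F has_vector_derivative c * exp (- \<i> * of_real s * of_real u) * R u + e u) (at u)" if u: "u \<ge> 1" for u
  proof -
    have 1: "((\<lambda>u. c * exp (- \<i> * of_real s * of_real u)) has_vector_derivative
        c * (exp (- \<i> * of_real s * of_real u) * (- \<i> * of_real s))) (at u)"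
      by (rule has_vector_derivative_real_field[where f = "\<lambda>z. c * exp (- \<i> * of_real s * z)"])
         (auto intro!: derivative_eq_intros)
    have "((\<lambda>z. z / (1 + \<i> * of_real d * z)) has_field_derivative 1 / (D u)\<^sup>2) (at (of_real u))"
      using D0[of u] by (auto intro!: derivative_eq_intros simp: D_def power2_eq_square)
    then have 2: "((\<lambda>u. of_real u / D u) has_vector_derivative 1 / (D u)\<^sup>2) (at u)"
      unfolding D_def by (rule has_vector_derivative_real_field)
    \<comment> \<open>The product rule for \<open>F\<close>, with \<open>x\<close>, \<open>r\<close>, \<open>r'\<close> for the
      values of the exponential, of \<open>R\<close> and of its conjugate. The main term arises from \<open>\<i> d u / D = 1 - 1 / D\<close>.\<close>
    have alg: "c * x * r * (1 / (D u)\<^sup>2)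
        + (c * x * (\<i> * of_real \<sigma> * r + (of_real \<beta> * r' - r / 2) / of_real u)
           + c * (x * (- \<i> * of_real s)) * r) * (of_real u / D u)
        = c * x * r + c * x * (r / (D u)\<^sup>2 + (of_real \<beta> * r' - r * (3 / 2)) / D u)" for x r r'
    proof -
      have i: "\<i> * (of_real \<sigma> - of_real s) * of_real u = D u - 1" by (simp add: D_def d_def)
      have "(c * x * (\<i> * of_real \<sigma> * r + (of_real \<beta> * r' - r / 2) / of_real u)
           + c * (x * (- \<i> * of_real s)) * r) * of_real u
          = c * x * r * (\<i> * (of_real \<sigma> - of_real s) * of_real u) + c * x * (of_real \<beta> * r' - r / 2)"
        using u by (simp add: field_simps)
      also have "\<dots> = c * x * (r * D u + of_real \<beta> * r' - r * (3 / 2))"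
        unfolding i by (simp add: algebra_simps)
      finally have "(c * x * (\<i> * of_real \<sigma> * r + (of_real \<beta> * r' - r / 2) / of_real u)
           + c * (x * (- \<i> * of_real s)) * r) * (of_real u / D u)
         = c * x * (r * D u + of_real \<beta> * r' - r * (3 / 2)) / D u"
        by (simp only: times_divide_eq_right)
      also have "\<dots> = c * x * r + c * x * ((of_real \<beta> * r' - r * (3 / 2)) / D u)"
        using D0[of u] by (simp add: field_simps)
      finally show ?thesis by (simp add: algebra_simps)
    qed
    show ?thesis
      using has_vector_derivative_mult[OF has_vector_derivative_mult[OF 1 R[OF u]] 2]
      unfolding F_def e_def alg by simp
  qed
  moreover have "norm (F u) \<le> sqrt K / 2" if u: "u \<ge> 1" for u
  proof -
    \<comment> \<open>Since \<open>2 x \<le> 1 + x\<^sup>2\<close>, the factor \<open>sqrt (\<bar>d\<bar> u)\<close> is absorbed by \<open>\<bar>D\<bar>\<close>.\<close>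
    have "2 * 1 * \<bar>d * u\<bar> \<le> 1\<^sup>2 + \<bar>d * u\<bar>\<^sup>2" by (rule sum_squares_bound)
    then have "2 * \<bar>d\<bar> * u \<le> (norm (D u))\<^sup>2"
      using u by (simp add: Dsq abs_mult power_mult_distrib)
    then have "sqrt (2 * \<bar>d\<bar> * u) \<le> norm (D u)" by (simp add: real_le_lsqrt)
    moreover have "sqrt (2 * \<bar>d\<bar> * u) = 2 * (sqrt (\<bar>d\<bar> / 2) * sqrt u)"
    proof -
      have "2 * \<bar>d\<bar> * u = 4 * (\<bar>d\<bar> / 2 * u)" by simp
      then show ?thesis by (simp only: real_sqrt_mult real_sqrt_four)
    qed
    ultimately have b: "sqrt (\<bar>d\<bar> / 2) * sqrt u / norm (D u) \<le> 1 / 2"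
      using D0[of u] by (simp add: divide_simps)
    have "norm (F u) = sqrt (\<bar>d\<bar> / 2) * norm (R u) * (u / norm (D u))"
      using u by (simp add: F_def norm_mult norm_divide En[simplified] cn)
    also have "\<dots> \<le> sqrt (\<bar>d\<bar> / 2) * (sqrt K / sqrt u) * (u / norm (D u))"
      using u Rn[OF u] by (intro mult_right_mono mult_left_mono) auto
    also have "\<dots> = sqrt K * (sqrt (\<bar>d\<bar> / 2) * (u / sqrt u) / norm (D u))" by simp
    also have "\<dots> = sqrt K * (sqrt (\<bar>d\<bar> / 2) * sqrt u / norm (D u))"
      using u by (subst real_div_sqrt) auto
    also have "\<dots> \<le> sqrt K * (1 / 2)"
      using b order_trans[OF mult_nonneg_nonneg decay[OF u]] u by (intro mult_left_mono) auto
    finally show ?thesis by simp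
  qed
  moreover have "norm (e u) \<le> 3 * sqrt K * (sqrt \<bar>\<sigma> - s\<bar> / (sqrt u * (1 + \<bar>\<sigma> - s\<bar> * u)))" if u: "u \<ge> 1" for u
  proof -
    have K0: "K \<ge> 0" using order_trans[OF mult_nonneg_nonneg decay[OF u]] u by simp
    have D1: "norm (D u) \<ge> 1" using Dsq[of u] by (intro power2_le_imp_le[of 1 "norm (D u)"]) auto
    have "(1 + \<bar>d\<bar> * u)\<^sup>2 \<le> 2 * (norm (D u))\<^sup>2"
      using sum_squares_bound[of 1 "\<bar>d\<bar> * u"] by (simp add: Dsq power2_sum power_mult_distrib)
    from real_sqrt_le_mono[OF this] have D2: "1 + \<bar>d\<bar> * u \<le> sqrt 2 * norm (D u)"
      using u by (simp add: real_sqrt_mult)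
    have "norm (R u / (D u)\<^sup>2 + (of_real \<beta> * cnj (R u) - R u * (3 / 2)) / D u)
        \<le> norm (R u) / (norm (D u))\<^sup>2 + (\<bar>\<beta>\<bar> * norm (R u) + norm (R u) * (3 / 2)) / norm (D u)"
      by (intro order_trans[OF norm_triangle_ineq] add_mono)
         (auto simp: norm_divide norm_power norm_mult intro!: divide_right_mono order_trans[OF norm_triangle_ineq4])
    also have "\<dots> \<le> norm (R u) / norm (D u) + (1 / 2 * norm (R u) + norm (R u) * (3 / 2)) / norm (D u)"
    proof (intro add_mono divide_right_mono mult_right_mono divide_left_mono)
      show "norm (D u) \<le> (norm (D u))\<^sup>2" using D1 by (rule self_le_power) simp
      show "0 < (norm (D u))\<^sup>2 * norm (D u)" using D0[of u] by simp
    qed (use \<beta> in auto)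
    also have "\<dots> = 3 * norm (R u) / norm (D u)" by (simp add: field_simps)
    finally have "sqrt (\<bar>d\<bar> / 2) * norm (R u / (D u)\<^sup>2 + (of_real \<beta> * cnj (R u) - R u * (3 / 2)) / D u)
        \<le> sqrt (\<bar>d\<bar> / 2) * (3 * norm (R u) / norm (D u))"
      by (rule mult_left_mono) simp
    then have "norm (e u) \<le> sqrt (\<bar>d\<bar> / 2) * (3 * norm (R u) / norm (D u))"
      by (simp only: e_def norm_mult En cn mult_1_right)
    also have "\<dots> \<le> sqrt (\<bar>d\<bar> / 2) * (3 * (sqrt K / sqrt u) / ((1 + \<bar>d\<bar> * u) / sqrt 2))"
      using D2 u Rn[OF u] D1 K0
      by (intro mult_left_mono frac_le) (auto simp: field_simps intro!: divide_pos_pos add_pos_nonneg)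
    also have "\<dots> = 3 * sqrt K * (sqrt \<bar>d\<bar> / (sqrt u * (1 + \<bar>d\<bar> * u)))"
      by (simp add: real_sqrt_divide field_simps)
    finally show ?thesis by (simp add: d_def)
  qed
  ultimately show thesis using that by blast
qed

text \<open>The total mass of the error bound in the previous lemma: the primitive has oscillation at most \<open>\<pi>\<close> for
every \<open>d\<close>.\<close>

lemma arctan_sqrt_deriv:
  fixes d u :: real
  assumes "u > 0"
  shows "((\<lambda>u. 2 * arctan (sqrt \<bar>d\<bar> * sqrt u)) has_real_derivative
    sqrt \<bar>d\<bar> / (sqrt u * (1 + \<bar>d\<bar> * u))) (at u)"
  using assms
  by (auto intro!: derivative_eq_intros simp: power_mult_distrib divide_simps add_pos_nonneg)

section \<open>One-sided Bessel series\<close>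

text \<open>Shifting the order by one multiplies the phase by \<open>x\<close>, so \<open>2 J\<^sub>\<nu>' = J\<^bsub>\<nu>-1\<^esub> - J\<^bsub>\<nu>+1\<^esub>\<close> turns the differentiated sum
into \<open>(x - 1/x) / 2 = \<i> sin \<psi>\<close> times the sum itself, up to boundary terms at both ends of the range. Those at
the lower end persist as \<open>N\<close> grows; those at the upper end tend to \<open>0\<close>.\<close>

lemma bessel_partial_sum_deriv:
  fixes N :: nat and \<mu> \<psi> u :: real
  assumes "\<mu> \<ge> 0" "u > 0"
  defines "x \<equiv> cis \<psi>"
  shows "((\<lambda>u. \<Sum>j<N. of_real (bessel_J (\<mu> + real j) u) * x ^ j) has_vector_derivative
     \<i> * of_real (sin \<psi>) * (\<Sum>j<N. of_real (bessel_J (\<mu> + real j) u) * x ^ j)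
     + (of_real (bessel_J (\<mu> - 1) u) + of_real (bessel_J \<mu> u) / x) / 2
     - (of_real (bessel_J (\<mu> + real N - 1) u) * x ^ N
        + of_real (bessel_J (\<mu> + real N) u) * x ^ N / x) / 2) (at u)"
proof -
  have x0: "x \<noteq> 0" by (simp add: x_def)
  let ?J = "\<lambda>\<nu>. complex_of_real (bessel_J \<nu> u)"
  let ?S = "\<Sum>j<N. ?J (\<mu> + real j) * x ^ j"
  have lower: "(\<Sum>j<N. ?J (\<mu> + real j - 1) * x ^ j)
      = ?J (\<mu> - 1) + x * ?S - ?J (\<mu> + real N - 1) * x ^ N"
    by (induction N) (simp_all add: algebra_simps)
  have upper: "x * (\<Sum>j<N. ?J (\<mu> + real j + 1) * x ^ j) = ?S - ?J \<mu> + ?J (\<mu> + real N) * x ^ N"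
    by (induction N) (simp_all add: algebra_simps)
  have "((\<lambda>u. of_real (bessel_J (\<mu> + real j) u) * x ^ j) has_vector_derivative
      of_real ((bessel_J (\<mu> + real j - 1) u - bessel_J (\<mu> + real j + 1) u) / 2) * x ^ j) (at u)" for j
    using bessel_J_deriv_symmetric[of "\<mu> + real j" u] assms
    by (intro has_vector_derivative_mult_left has_vector_derivative_of_real)
       (simp add: has_real_derivative_iff_has_vector_derivative)
  then have "((\<lambda>u. \<Sum>j<N. of_real (bessel_J (\<mu> + real j) u) * x ^ j) has_vector_derivative
     (\<Sum>j<N. of_real ((bessel_J (\<mu> + real j - 1) u - bessel_J (\<mu> + real j + 1) u) / 2) * x ^ j)) (at u)"
    by (intro has_vector_derivative_sum) auto
  also have "(\<Sum>j<N. of_real ((bessel_J (\<mu> + real j - 1) u - bessel_J (\<mu> + real j + 1) u) / 2) * x ^ j)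
      = ((\<Sum>j<N. ?J (\<mu> + real j - 1) * x ^ j) - x * (\<Sum>j<N. ?J (\<mu> + real j + 1) * x ^ j) / x) / 2"
    using x0 by (simp add: sum_subtractf sum_divide_distrib diff_divide_distrib left_diff_distrib)
  also have "\<dots> = ((x - 1 / x) / 2) * ?S + (?J (\<mu> - 1) + ?J \<mu> / x) / 2
      - (?J (\<mu> + real N - 1) * x ^ N + ?J (\<mu> + real N) * x ^ N / x) / 2"
    unfolding lower upper using x0 by (simp add: field_simps)
  also have "(x - 1 / x) / 2 = \<i> * of_real (sin \<psi>)"
    by (simp add: x_def complex_eq_iff cis_divide[symmetric] flip: cis_inverse inverse_eq_divide)
  finally show ?thesis .
qed

lemma bessel_summable:
  assumes "\<mu> \<ge> 0" "z > 0"
  shows "summable (\<lambda>j. \<bar>bessel_J (\<mu> + real j) z\<bar>)"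
    "(\<Sum>j. \<bar>bessel_J (\<mu> + real j) z\<bar>)
      \<le> rGamma (\<mu> + 1) * exp ((z / 2)\<^sup>2) * (z / 2) powr \<mu> * exp (z / 2)"
proof -
  let ?g = "\<lambda>j. rGamma (\<mu> + 1) * exp ((z / 2)\<^sup>2) * (z / 2) powr \<mu> * (inverse (fact j) * (z / 2) ^ j)"
  have g: "?g sums (rGamma (\<mu> + 1) * exp ((z / 2)\<^sup>2) * (z / 2) powr \<mu> * exp (z / 2))"
    by (intro sums_mult) (use exp_converges[of "z / 2"] in \<open>simp add: scaleR_conv_of_real\<close>)
  have le: "\<bar>bessel_J (\<mu> + real j) z\<bar> \<le> ?g j" for j
    by (rule bessel_J_bound) (use assms in auto)
  show s: "summable (\<lambda>j. \<bar>bessel_J (\<mu> + real j) z\<bar>)"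
    by (rule summable_comparison_test'[OF sums_summable[OF g]]) (use le in simp)
  show "(\<Sum>j. \<bar>bessel_J (\<mu> + real j) z\<bar>)
      \<le> rGamma (\<mu> + 1) * exp ((z / 2)\<^sup>2) * (z / 2) powr \<mu> * exp (z / 2)"
    using suminf_le[OF le s sums_summable[OF g]] sums_unique[OF g] by simp
qed

lemma bessel_J_uniformly_small:
  assumes "\<mu> \<ge> 0" "w > 0" "\<epsilon> > 0"
  obtains N0 :: nat where "\<And>N u. N \<ge> N0 \<Longrightarrow> 0 < u \<Longrightarrow> u \<le> w \<Longrightarrow> \<bar>bessel_J (\<mu> + real N) u\<bar> \<le> \<epsilon>"
proof -
  let ?g = "\<lambda>j. rGamma (\<mu> + 1) * exp ((w / 2)\<^sup>2) * (w / 2) powr \<mu> * (inverse (fact j) * (w / 2) ^ j)"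
  have "summable ?g" by (intro summable_mult summable_exp)
  then have "?g \<longlonglongrightarrow> 0" by (rule summable_LIMSEQ_zero)
  then have "eventually (\<lambda>N. ?g N < \<epsilon>) sequentially"
    using assms by (auto dest: order_tendstoD)
  then obtain N0 where "\<And>N. N \<ge> N0 \<Longrightarrow> ?g N < \<epsilon>" by (auto simp: eventually_sequentially)
  then show thesis using that[of N0] bessel_J_bound[OF assms(1)] by (meson less_imp_le order_trans)
qed

text \<open>\<open>P = A + \<i>B\<close> is the combination of \<open>J\<^bsub>\<mu>-1\<^esub>\<close> and \<open>J\<^sub>\<mu>\<close> with frequency \<open>1\<close>, and its conjugate has frequency \<open>-1\<close>. The
driving term of the differential equation can resonate with \<open>exp(\<i> u sin \<psi>)\<close> only when \<open>sin \<psi>\<close> is near \<open>1\<close> or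
\<open>-1\<close>, and there the coefficient of the resonant part is small, of precisely the size required above.\<close>

lemma bessel_phase_decomposition:
  fixes A B \<psi> :: real
  defines "P \<equiv> Complex A B"
  shows "(1 - \<i> / cis \<psi>) / 2 * P + (1 + \<i> / cis \<psi>) / 2 * cnj P = of_real A + of_real B / cis \<psi>"
    "(norm ((1 - \<i> / cis \<psi>) / 2))\<^sup>2 = \<bar>1 - sin \<psi>\<bar> / 2"
    "(norm ((1 + \<i> / cis \<psi>) / 2))\<^sup>2 = \<bar>- 1 - sin \<psi>\<bar> / 2"
proof -
  have inv: "y / cis \<psi> = y * cis (- \<psi>)" for y by (simp add: divide_inverse cis_inverse)
  show "(1 - \<i> / cis \<psi>) / 2 * P + (1 + \<i> / cis \<psi>) / 2 * cnj P = of_real A + of_real B / cis \<psi>"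
    unfolding inv by (simp add: P_def complex_eq_iff field_simps)
  have s: "sin \<psi> \<le> 1" "sin \<psi> \<ge> -1" "(cos \<psi>)\<^sup>2 = 1 - (sin \<psi>)\<^sup>2" by (auto simp: cos_squared_eq)
  show "(norm ((1 - \<i> / cis \<psi>) / 2))\<^sup>2 = \<bar>1 - sin \<psi>\<bar> / 2"
    "(norm ((1 + \<i> / cis \<psi>) / 2))\<^sup>2 = \<bar>- 1 - sin \<psi>\<bar> / 2"
    unfolding inv using s by (simp_all add: cmod_power2 power_divide power2_sum power2_diff field_simps)
qed

text \<open>After multiplication by \<open>exp(-\<i> u sin \<psi>)\<close>, the derivative of a partial sum is the oscillating driving term
plus the vanishing boundary terms at the upper end. Subtracting the approximate primitives of the two
frequencies \<open>\<plusminus>1\<close> leaves, up to these boundary terms, a function whose derivative is integrable uniformly in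
\<open>\<psi>\<close>. Partial sums are used
so that no series has to be differentiated. For \<open>w \<le> 1\<close> the series is bounded termwise.\<close>

lemma one_sided_bessel_series_bounded:
  assumes \<mu>: "0 \<le> \<mu>" "\<mu> < 1"
  obtains C where "\<And>w \<psi>. w > 0 \<Longrightarrow> norm (\<Sum>j. of_real (bessel_J (\<mu> + real j) w) * cis \<psi> ^ j) \<le> C"
proof -
  obtain K where K0: "K \<ge> 0"
    and K: "\<And>u. u \<ge> 1 \<Longrightarrow> u * ((bessel_J (\<mu> - 1) u)\<^sup>2 + (bessel_J \<mu> u)\<^sup>2) \<le> K"
    using bessel_pair_decay[OF \<mu>] by blast
  define C0 where "C0 = rGamma (\<mu> + 1) * exp 1 * 1 * exp 1"
  define h where "h N \<psi> w = (\<Sum>j<N. of_real (bessel_J (\<mu> + real j) w) * cis \<psi> ^ j)" for N \<psi> w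
  have summ: "summable (\<lambda>j. norm (of_real (bessel_J (\<mu> + real j) w) * cis \<psi> ^ j))" if "w > 0" for w \<psi>
    using bessel_summable(1)[OF \<mu>(1) that] by (simp add: norm_mult norm_power)
  have small: "norm (h N \<psi> w) \<le> C0" if "0 < w" "w \<le> 1" for N \<psi> w
  proof -
    have g: "rGamma (\<mu> + 1) > 0" using rGamma_shift_bound(1)[of "\<mu> + 1" 0] \<mu> by simp
    have "norm (h N \<psi> w) \<le> (\<Sum>j<N. \<bar>bessel_J (\<mu> + real j) w\<bar>)"
      unfolding h_def by (intro sum_norm_le) (simp add: norm_mult norm_power)
    also have "\<dots> \<le> (\<Sum>j. \<bar>bessel_J (\<mu> + real j) w\<bar>)"
      by (intro sum_le_suminf bessel_summable) (use that \<mu> in auto)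
    also have "\<dots> \<le> rGamma (\<mu> + 1) * exp ((w / 2)\<^sup>2) * (w / 2) powr \<mu> * exp (w / 2)"
      by (rule bessel_summable) (use that \<mu> in auto)
    also have "\<dots> \<le> C0"
      unfolding C0_def using that g \<mu>
      by (intro mult_mono) (auto intro!: powr_le1 power_le_one)
    finally show ?thesis .
  qed
  have large: "norm (\<Sum>j. of_real (bessel_J (\<mu> + real j) w) * cis \<psi> ^ j)
      \<le> C0 + sqrt K + 3 * sqrt K * pi" if w: "w > 1" for w \<psi>
  proof -
    define s where "s = sin \<psi>"
    define P where "P u = Complex (bessel_J (\<mu> - 1) u) (bessel_J \<mu> u)" for u
    define Ex where "Ex u = exp (- \<i> * of_real s * of_real u)" for u :: real
    have Exn: "norm (Ex u) = 1" for u by (simp add: Ex_def norm_exp_eq_Re)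
    define c1 where "c1 = (1 - \<i> / cis \<psi>) / 2"
    define c2 where "c2 = (1 + \<i> / cis \<psi>) / 2"
    have Pd: "(P has_vector_derivative \<i> * of_real 1 * P u
        + (of_real (\<mu> - 1 / 2) * cnj (P u) - P u / 2) / of_real u) (at u)" if u: "u \<ge> 1" for u
    proof -
      have "(bessel_J (\<mu> - 1) has_real_derivative (\<mu> - 1) / u * bessel_J (\<mu> - 1) u - bessel_J \<mu> u) (at u)"
        using bessel_J_deriv[of "\<mu> - 1" u] u \<mu> by simp
      moreover have "(bessel_J \<mu> has_real_derivative bessel_J (\<mu> - 1) u - \<mu> / u * bessel_J \<mu> u) (at u)"
        using bessel_J_deriv_lower[of \<mu> u] u \<mu> by simp
      ultimately have "((\<lambda>u. of_real (bessel_J (\<mu> - 1) u) + \<i> * of_real (bessel_J \<mu> u)) has_vector_derivative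
          of_real ((\<mu> - 1) / u * bessel_J (\<mu> - 1) u - bessel_J \<mu> u)
          + \<i> * of_real (bessel_J (\<mu> - 1) u - \<mu> / u * bessel_J \<mu> u)) (at u)"
        by (intro has_vector_derivative_add has_vector_derivative_mult_right has_vector_derivative_of_real)
      moreover have "P = (\<lambda>u. of_real (bessel_J (\<mu> - 1) u) + \<i> * of_real (bessel_J \<mu> u))"
        by (auto simp: P_def fun_eq_iff complex_eq_iff)
      moreover have "of_real ((\<mu> - 1) / u * bessel_J (\<mu> - 1) u - bessel_J \<mu> u)
          + \<i> * of_real (bessel_J (\<mu> - 1) u - \<mu> / u * bessel_J \<mu> u)
        = \<i> * of_real 1 * P u + (of_real (\<mu> - 1 / 2) * cnj (P u) - P u / 2) / of_real u"
        using u by (simp add: P_def complex_eq_iff field_simps)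
      ultimately show ?thesis by (simp only:)
    qed
    have Qd: "((\<lambda>u. cnj (P u)) has_vector_derivative \<i> * of_real (- 1) * cnj (P u)
        + (of_real (\<mu> - 1 / 2) * cnj (cnj (P u)) - cnj (P u) / 2) / of_real u) (at u)" if u: "u \<ge> 1" for u
      using has_vector_derivative_cnj[OF Pd[OF u]] by simp
    have Pn: "u * (norm (P u))\<^sup>2 \<le> K" if "u \<ge> 1" for u
      using K[OF that] by (simp add: P_def cmod_power2)
    have \<beta>: "\<bar>\<mu> - 1 / 2\<bar> \<le> 1 / 2" using \<mu> by (intro abs_leI) auto
    obtain F1 e1 where 1:
      "\<And>u. u \<ge> 1 \<Longrightarrow> (F1 has_vector_derivative c1 * Ex u * P u + e1 u) (at u)"
      "\<And>u. u \<ge> 1 \<Longrightarrow> norm (F1 u) \<le> sqrt K / 2"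
      "\<And>u. u \<ge> 1 \<Longrightarrow> norm (e1 u) \<le> 3 * sqrt K * (sqrt \<bar>1 - s\<bar> / (sqrt u * (1 + \<bar>1 - s\<bar> * u)))"
      using corrected_oscillatory_primitive[OF Pd Pn \<beta> bessel_phase_decomposition(2)[of \<psi>]]
      unfolding Ex_def c1_def s_def by blast
    obtain F2 e2 where 2:
      "\<And>u. u \<ge> 1 \<Longrightarrow> (F2 has_vector_derivative c2 * Ex u * cnj (P u) + e2 u) (at u)"
      "\<And>u. u \<ge> 1 \<Longrightarrow> norm (F2 u) \<le> sqrt K / 2"
      "\<And>u. u \<ge> 1 \<Longrightarrow> norm (e2 u) \<le> 3 * sqrt K * (sqrt \<bar>- 1 - s\<bar> / (sqrt u * (1 + \<bar>- 1 - s\<bar> * u)))"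
      using corrected_oscillatory_primitive[OF Qd _ \<beta> bessel_phase_decomposition(3)[of \<psi>], of K] Pn
      unfolding Ex_def c2_def s_def by (auto simp del: of_real_minus)
    have approx: "norm (h N \<psi> w) \<le> C0 + sqrt K + 3 * sqrt K * pi + \<epsilon> * (w - 1)"
      if N: "\<And>u. 0 < u \<Longrightarrow> u \<le> w \<Longrightarrow> \<bar>bessel_J (\<mu> + real N) u\<bar> \<le> \<epsilon>"
        "\<And>u. 0 < u \<Longrightarrow> u \<le> w \<Longrightarrow> \<bar>bessel_J (\<mu> + real N - 1) u\<bar> \<le> \<epsilon>" for N \<epsilon>
    proof -
      define r where "r u = (of_real (bessel_J (\<mu> + real N - 1) u) * cis \<psi> ^ N
        + of_real (bessel_J (\<mu> + real N) u) * cis \<psi> ^ N / cis \<psi>) / 2" for u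
      \<comment> \<open>\<open>X\<close> is what remains of the partial sum, \<open>X'\<close> its derivative, and \<open>\<phi>\<close> dominates its
        variation; \<open>\<epsilon>\<close> accounts for the boundary terms at the upper end.\<close>
      define X where "X u = Ex u * h N \<psi> u - (F1 u + F2 u) / 2" for u
      define X' where "X' u = - (Ex u * r u) - (e1 u + e2 u) / 2" for u
      define \<phi> where "\<phi> u = \<epsilon> * u + 3 * sqrt K / 2 * (2 * arctan (sqrt \<bar>1 - s\<bar> * sqrt u)
        + 2 * arctan (sqrt \<bar>- 1 - s\<bar> * sqrt u))" for u
      define \<phi>' where "\<phi>' u = \<epsilon> + 3 * sqrt K / 2 * (sqrt \<bar>1 - s\<bar> / (sqrt u * (1 + \<bar>1 - s\<bar> * u))
        + sqrt \<bar>- 1 - s\<bar> / (sqrt u * (1 + \<bar>- 1 - s\<bar> * u)))" for u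
      have Xd: "(X has_vector_derivative X' u) (at u)" if u: "u \<ge> 1" for u
      proof -
        have E: "(Ex has_vector_derivative Ex u * (- \<i> * of_real s)) (at u)"
          unfolding Ex_def
          by (rule has_vector_derivative_real_field[where f = "\<lambda>z. exp (- \<i> * of_real s * z)"])
             (auto intro!: derivative_eq_intros)
        have H: "(h N \<psi> has_vector_derivative \<i> * of_real s * h N \<psi> u
            + (c1 * P u + c2 * cnj (P u)) / 2 - r u) (at u)"
          using bessel_partial_sum_deriv[OF \<mu>(1), where u = u and N = N and \<psi> = \<psi>] u
          unfolding h_def[abs_def] r_def s_def c1_def c2_def P_def bessel_phase_decomposition(1) by simp
        have "(X has_vector_derivative (Ex u * (\<i> * of_real s * h N \<psi> u
            + (c1 * P u + c2 * cnj (P u)) / 2 - r u) + Ex u * (- \<i> * of_real s) * h N \<psi> u)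
            - ((c1 * Ex u * P u + e1 u) + (c2 * Ex u * cnj (P u) + e2 u)) / 2) (at u)"
          unfolding X_def[abs_def]
          by (intro has_vector_derivative_diff has_vector_derivative_mult E H
              has_vector_derivative_divide has_vector_derivative_add 1(1) 2(1) u)
        then show ?thesis
          by (rule has_vector_derivative_eq_rhs) (simp add: X'_def field_simps)
      qed
      have \<phi>d: "(\<phi> has_vector_derivative \<phi>' u) (at u)" if "u \<ge> 1" for u
      proof -
        have "(\<phi> has_real_derivative \<epsilon> * 1 + 3 * sqrt K / 2 * (sqrt \<bar>1 - s\<bar> / (sqrt u * (1 + \<bar>1 - s\<bar> * u))
        + sqrt \<bar>- 1 - s\<bar> / (sqrt u * (1 + \<bar>- 1 - s\<bar> * u)))) (at u)"
          unfolding \<phi>_def[abs_def]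
          by (intro DERIV_add DERIV_cmult DERIV_ident arctan_sqrt_deriv) (use that in auto)
        then show ?thesis by (simp add: \<phi>'_def has_real_derivative_iff_has_vector_derivative)
      qed
      have bd: "norm (X' u) \<le> \<phi>' u" if "1 < u" "u < w" for u
      proof -
        have "norm (of_real (bessel_J (\<mu> + real N - 1) u) * cis \<psi> ^ N
          + of_real (bessel_J (\<mu> + real N) u) * cis \<psi> ^ N / cis \<psi>) \<le> \<epsilon> + \<epsilon>"
          using N[of u] that
          by (intro order_trans[OF norm_triangle_ineq] add_mono) (auto simp: norm_mult norm_power norm_divide)
        then have i1: "norm (Ex u * r u) \<le> \<epsilon>" by (simp add: r_def norm_mult Exn norm_divide)
        have i2: "norm ((e1 u + e2 u) / 2) \<le> 3 * sqrt K / 2 * (sqrt \<bar>1 - s\<bar> / (sqrt u * (1 + \<bar>1 - s\<bar> * u))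
        + sqrt \<bar>- 1 - s\<bar> / (sqrt u * (1 + \<bar>- 1 - s\<bar> * u)))"
        proof -
          have "norm (e1 u + e2 u) / 2 \<le> (norm (e1 u) + norm (e2 u)) / 2"
            using norm_triangle_ineq[of "e1 u" "e2 u"] by simp
          also have "\<dots> \<le> (3 * sqrt K * (sqrt \<bar>1 - s\<bar> / (sqrt u * (1 + \<bar>1 - s\<bar> * u)))
            + 3 * sqrt K * (sqrt \<bar>- 1 - s\<bar> / (sqrt u * (1 + \<bar>- 1 - s\<bar> * u)))) / 2"
            using 1(3)[of u] 2(3)[of u] that by (intro divide_right_mono add_mono) auto
          finally show ?thesis by (simp only: norm_divide) (simp add: distrib_left add_divide_distrib mult_ac)
        qed
        have "norm (X' u) \<le> norm (Ex u * r u) + norm ((e1 u + e2 u) / 2)"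
          unfolding X'_def by (metis norm_minus_cancel norm_triangle_ineq4)
        also note add_mono[OF i1 i2]
        finally show ?thesis unfolding \<phi>'_def .
      qed
      have "norm (X w - X 1) \<le> \<phi> w - \<phi> 1"
      proof (rule differentiable_bound_general[OF w])
        show "continuous_on {1..w} X"
          by (intro continuous_at_imp_continuous_on ballI has_vector_derivative_continuous[OF Xd]) auto
        show "continuous_on {1..w} \<phi>"
          by (intro continuous_at_imp_continuous_on ballI has_vector_derivative_continuous[OF \<phi>d]) auto
        show "(X has_vector_derivative X' u) (at u)" if "1 < u" for u
          using Xd[of u] that by simp
        show "(\<phi> has_vector_derivative \<phi>' u) (at u)" if "1 < u" for u
          using \<phi>d[of u] that by simp
      qed (rule bd)
      also have "\<dots> \<le> \<epsilon> * (w - 1) + 3 * sqrt K * pi"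
      proof -
        have "arctan (sqrt \<bar>d\<bar> * sqrt w) - arctan (sqrt \<bar>d\<bar> * sqrt 1) \<le> pi / 2" for d
        proof -
          have "0 \<le> arctan (sqrt \<bar>d\<bar> * sqrt 1)" by (simp add: zero_le_arctan_iff)
          then show ?thesis using arctan_ubound[of "sqrt \<bar>d\<bar> * sqrt w"] by linarith
        qed
        from this[of "1 - s"] this[of "- 1 - s"]
        have "3 * sqrt K / 2 * (2 * arctan (sqrt \<bar>1 - s\<bar> * sqrt w) + 2 * arctan (sqrt \<bar>- 1 - s\<bar> * sqrt w)
          - (2 * arctan (sqrt \<bar>1 - s\<bar> * sqrt 1) + 2 * arctan (sqrt \<bar>- 1 - s\<bar> * sqrt 1)))
          \<le> 3 * sqrt K / 2 * (2 * pi)"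
          using K0 by (intro mult_left_mono) auto
        then show ?thesis by (simp only: \<phi>_def) (simp add: algebra_simps)
      qed
      finally have XX: "norm (X w - X 1) \<le> \<epsilon> * (w - 1) + 3 * sqrt K * pi" .
      have FF: "norm ((F1 u + F2 u) / 2) \<le> sqrt K / 2" if "u \<ge> 1" for u
        using 1(2)[OF that] 2(2)[OF that] norm_triangle_ineq[of "F1 u" "F2 u"] by (simp add: norm_divide)
      have eq: "Ex w * h N \<psi> w = (X w - X 1) + Ex 1 * h N \<psi> 1 + ((F1 w + F2 w) / 2 - (F1 1 + F2 1) / 2)"
        by (simp add: X_def)
      have "norm (h N \<psi> w) = norm (Ex w * h N \<psi> w)" by (simp add: norm_mult Exn)
      also have "\<dots> \<le> norm (X w - X 1) + norm (Ex 1 * h N \<psi> 1)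
          + (norm ((F1 w + F2 w) / 2) + norm ((F1 1 + F2 1) / 2))"
        unfolding eq
        by (intro order_trans[OF norm_triangle_ineq] add_mono norm_triangle_ineq norm_triangle_ineq4)
      also have "\<dots> \<le> (\<epsilon> * (w - 1) + 3 * sqrt K * pi) + C0 + (sqrt K / 2 + sqrt K / 2)"
        using XX FF[of w] FF[of 1] small[of 1 N \<psi>] w
        by (intro add_mono) (auto simp: norm_mult Exn)
      finally show ?thesis by simp
    qed
    have lim: "(\<lambda>N. norm (h N \<psi> w)) \<longlonglongrightarrow> norm (\<Sum>j. of_real (bessel_J (\<mu> + real j) w) * cis \<psi> ^ j)"
      unfolding h_def using summable_LIMSEQ[OF summable_norm_cancel[OF summ]] w
      by (intro tendsto_norm) auto
    show ?thesis
    proof (rule field_le_epsilon)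
      fix \<epsilon> :: real assume \<epsilon>: "\<epsilon> > 0"
      define \<delta> where "\<delta> = \<epsilon> / (w - 1)"
      have \<delta>: "\<delta> > 0" "\<delta> * (w - 1) = \<epsilon>" using \<epsilon> w by (auto simp: \<delta>_def)
      obtain N0 where N0: "\<And>N u. N \<ge> N0 \<Longrightarrow> 0 < u \<Longrightarrow> u \<le> w \<Longrightarrow> \<bar>bessel_J (\<mu> + real N) u\<bar> \<le> \<delta>"
        using bessel_J_uniformly_small[OF \<mu>(1) _ \<delta>(1), of w] w by auto
      have "norm (h N \<psi> w) \<le> C0 + sqrt K + 3 * sqrt K * pi + \<epsilon>" if N: "N \<ge> Suc N0" for N
      proof -
        obtain M where M: "N = Suc M" "M \<ge> N0" using N by (cases N) auto
        have "\<bar>bessel_J (\<mu> + real N - 1) u\<bar> \<le> \<delta>" if "0 < u" "u \<le> w" for u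
          using N0[OF M(2) that] by (simp add: M(1))
        from approx[OF N0 this, unfolded \<delta>(2)] show ?thesis using N by auto
      qed
      with lim show "norm (\<Sum>j. of_real (bessel_J (\<mu> + real j) w) * cis \<psi> ^ j)
          \<le> C0 + sqrt K + 3 * sqrt K * pi + \<epsilon>"
        by (intro Lim_bounded[OF lim]) auto
    qed
  qed
  have "norm (\<Sum>j. of_real (bessel_J (\<mu> + real j) w) * cis \<psi> ^ j) \<le> C0 + sqrt K + 3 * sqrt K * pi"
    if "w > 0" for w \<psi>
  proof (cases "w \<le> 1")
    case True
    have "(\<lambda>N. norm (h N \<psi> w)) \<longlonglongrightarrow> norm (\<Sum>j. of_real (bessel_J (\<mu> + real j) w) * cis \<psi> ^ j)"
      unfolding h_def using summable_LIMSEQ[OF summable_norm_cancel[OF summ[OF that]]]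
      by (intro tendsto_norm) auto
    then have "norm (\<Sum>j. of_real (bessel_J (\<mu> + real j) w) * cis \<psi> ^ j) \<le> C0"
      by (rule Lim_bounded) (use small[OF that True] in auto)
    also have "\<dots> \<le> C0 + sqrt K + 3 * sqrt K * pi" using K0 by simp
    finally show ?thesis .
  qed (use large in auto)
  then show thesis using that by blast
qed

section \<open>Arithmetic progressions of orders\<close>

text \<open>Writing \<open>m = j q + r\<close> splits the series into \<open>q\<close> series of the same kind, each with its own constant phase.
For orders \<open>m / q\<close> every class has integer steps.\<close>

lemma norm_phase_series_le_residue_classes:
  fixes f :: "nat \<Rightarrow> complex" and q :: nat
  assumes q: "q > 0"
    and summ: "\<And>r. r < q \<Longrightarrow> summable (\<lambda>j. norm (f (j * q + r)))"
    and bound: "\<And>r. r < q \<Longrightarrow> norm (\<Sum>j. f (j * q + r) * cis (real q * \<psi>) ^ j) \<le> C r"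
  shows "summable (\<lambda>m. norm (f m))" "norm (\<Sum>m. f m * cis \<psi> ^ m) \<le> (\<Sum>r<q. C r)"
proof -
  have block: "sum g {j * q..<j * q + q} = (\<Sum>r<q. g (j * q + r))" for g :: "nat \<Rightarrow> 'b::comm_monoid_add" and j
    using sum.shift_bounds_nat_ivl[of g 0 "j * q" q]
    by (simp add: add.commute[of _ "j * q"] lessThan_atLeast0)
  show s: "summable (\<lambda>m. norm (f m))"
  proof (rule summableI_nonneg_bounded)
    fix n
    have "(\<Sum>m<n. norm (f m)) \<le> (\<Sum>m<n * q. norm (f m))"
      using q by (intro sum_mono2) auto
    also have "\<dots> = (\<Sum>j<n. \<Sum>m\<in>{j * q..<j * q + q}. norm (f m))"
      by (rule sum.nat_group[symmetric])
    also have "\<dots> = (\<Sum>j<n. \<Sum>r<q. norm (f (j * q + r)))" by (simp only: block)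
    also have "\<dots> = (\<Sum>r<q. \<Sum>j<n. norm (f (j * q + r)))" by (rule sum.swap)
    also have "\<dots> \<le> (\<Sum>r<q. \<Sum>j. norm (f (j * q + r)))"
      by (intro sum_mono sum_le_suminf summ) auto
    finally show "(\<Sum>m<n. norm (f m)) \<le> (\<Sum>r<q. \<Sum>j. norm (f (j * q + r)))" .
  qed auto
  have "summable (\<lambda>m. f m * cis \<psi> ^ m)"
    by (rule summable_norm_cancel) (use s in \<open>simp add: norm_mult norm_power\<close>)
  from sums_group[OF summable_sums[OF this] q]
  have "(\<lambda>j. \<Sum>r<q. f (j * q + r) * cis \<psi> ^ (j * q + r)) sums (\<Sum>m. f m * cis \<psi> ^ m)"
    by (simp only: block)
  moreover have "(\<lambda>j. \<Sum>r<q. f (j * q + r) * cis \<psi> ^ (j * q + r)) sums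
      (\<Sum>r<q. cis \<psi> ^ r * (\<Sum>j. f (j * q + r) * cis (real q * \<psi>) ^ j))"
  proof (rule sums_sum)
    fix r assume r: "r \<in> {..<q}"
    have "summable (\<lambda>j. f (j * q + r) * cis (real q * \<psi>) ^ j)"
      by (rule summable_norm_cancel) (use r summ in \<open>simp add: norm_mult norm_power\<close>)
    then have "(\<lambda>j. cis \<psi> ^ r * (f (j * q + r) * cis (real q * \<psi>) ^ j)) sums
        (cis \<psi> ^ r * (\<Sum>j. f (j * q + r) * cis (real q * \<psi>) ^ j))"
      by (intro sums_mult summable_sums)
    moreover have "cis \<psi> ^ r * (f (j * q + r) * cis (real q * \<psi>) ^ j) = f (j * q + r) * cis \<psi> ^ (j * q + r)" for j
    proof -
      have "cis (real q * \<psi>) ^ j = cis \<psi> ^ (j * q)"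
        by (simp add: Complex.DeMoivre mult_ac)
      then show ?thesis by (simp add: power_add)
    qed
    ultimately show "(\<lambda>j. f (j * q + r) * cis \<psi> ^ (j * q + r)) sums
        (cis \<psi> ^ r * (\<Sum>j. f (j * q + r) * cis (real q * \<psi>) ^ j))" by simp
  qed
  ultimately have "(\<Sum>m. f m * cis \<psi> ^ m) = (\<Sum>r<q. cis \<psi> ^ r * (\<Sum>j. f (j * q + r) * cis (real q * \<psi>) ^ j))"
    by (rule sums_unique2)
  then show "norm (\<Sum>m. f m * cis \<psi> ^ m) \<le> (\<Sum>r<q. C r)"
    using bound by (simp only:) (rule sum_norm_le, simp add: norm_mult norm_power)
qed

lemma roots_of_unity_filter:
  fixes p m :: nat
  assumes "p > 0"
  shows "(\<Sum>r<p. cis (2 * pi * real r / real p) ^ m) = (if p dvd m then of_nat p else 0)"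
proof -
  define \<omega> where "\<omega> = cis (2 * pi * real m / real p)"
  have pow: "cis (2 * pi * real r / real p) ^ m = \<omega> ^ r" for r
    by (simp add: \<omega>_def Complex.DeMoivre mult_ac)
  have one: "\<omega> ^ p = 1"
  proof -
    have "\<omega> ^ p = cis (2 * pi * real m)" using assms by (simp add: \<omega>_def Complex.DeMoivre)
    also have "\<dots> = 1" by (rule cis_multiple_2pi) simp
    finally show ?thesis .
  qed
  have dvd: "\<omega> = 1 \<longleftrightarrow> p dvd m"
  proof
    assume "\<omega> = 1"
    then have "cos (2 * pi * real m / real p) = 1" by (simp add: \<omega>_def complex_eq_iff)
    then obtain n :: int where "2 * pi * real m / real p = real_of_int n * 2 * pi"
      using cos_one_2pi_int by blast
    then have "real m = real_of_int n * real p" using assms by (simp add: field_simps)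
    then have "int m = n * int p" by (metis of_int_eq_iff of_int_mult of_int_of_nat_eq)
    then show "p dvd m" by (metis dvd_triv_right int_dvd_int_iff)
  next
    assume "p dvd m"
    then obtain k where "m = p * k" by auto
    then have "2 * pi * real m / real p = 2 * pi * real k" using assms by simp
    then have "\<omega> = cis (2 * pi * real k)" by (simp only: \<omega>_def)
    also have "\<dots> = 1" by (rule cis_multiple_2pi) simp
    finally show "\<omega> = 1" .
  qed
  show ?thesis
  proof (cases "\<omega> = 1")
    case True
    then show ?thesis using dvd by (simp add: pow)
  next
    case False
    then show ?thesis using dvd one by (simp add: pow geometric_sum)
  qed
qed

text \<open>The subseries over the multiples of \<open>p\<close> is the mean of the full series at the \<open>p\<close> arguments
\<open>(\<eta> + 2\<pi>r) / p\<close>, and a mean does not exceed a uniform bound.\<close>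

lemma norm_phase_subseries_le:
  fixes f :: "nat \<Rightarrow> complex" and p :: nat
  assumes p: "p > 0" and summ: "summable (\<lambda>m. norm (f m))"
    and bound: "\<And>\<psi>. norm (\<Sum>m. f m * cis \<psi> ^ m) \<le> C"
  shows "norm (\<Sum>k. f (k * p) * cis \<eta> ^ k) \<le> C"
proof -
  define a where "a r = (\<eta> + 2 * pi * real r) / real p" for r :: nat
  have conv: "summable (\<lambda>m. f m * cis \<psi> ^ m)" for \<psi>
    by (rule summable_norm_cancel) (use summ in \<open>simp add: norm_mult norm_power\<close>)
  have avg: "(\<Sum>r<p. f m * cis (a r) ^ m) = (if p dvd m then of_nat p * (f m * cis (\<eta> / real p) ^ m) else 0)" for m
  proof -
    have "cis (a r) = cis (\<eta> / real p) * cis (2 * pi * real r / real p)" for r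
      by (simp add: a_def cis_mult add_divide_distrib)
    then have "(\<Sum>r<p. f m * cis (a r) ^ m)
        = f m * cis (\<eta> / real p) ^ m * (\<Sum>r<p. cis (2 * pi * real r / real p) ^ m)"
      by (simp add: power_mult_distrib sum_distrib_left mult.assoc)
    then show ?thesis by (simp add: roots_of_unity_filter[OF p])
  qed
  have "(\<lambda>m. \<Sum>r<p. f m * cis (a r) ^ m) sums (\<Sum>r<p. \<Sum>m. f m * cis (a r) ^ m)"
    by (intro sums_sum summable_sums conv)
  from sums_group[OF this p]
  have "(\<lambda>k. \<Sum>m\<in>{k * p..<k * p + p}. if p dvd m then of_nat p * (f m * cis (\<eta> / real p) ^ m) else 0)
      sums (\<Sum>r<p. \<Sum>m. f m * cis (a r) ^ m)"
    by (simp only: avg)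
  moreover have "(\<Sum>m\<in>{k * p..<k * p + p}. if p dvd m then of_nat p * (f m * cis (\<eta> / real p) ^ m) else 0)
      = of_nat p * (f (k * p) * cis \<eta> ^ k)" for k
  proof -
    have "m = k * p" if "p dvd m" "k * p \<le> m" "m < k * p + p" for m
    proof -
      obtain l where l: "m = l * p" using \<open>p dvd m\<close> by (metis dvdE mult.commute)
      have "k \<le> l" "l < Suc k"
        using that p by (auto simp: l) (metis add.commute mult_Suc mult_less_cancel2)
      then show ?thesis using l by simp
    qed
    then have "(\<Sum>m\<in>{k * p..<k * p + p}. if p dvd m then of_nat p * (f m * cis (\<eta> / real p) ^ m) else 0)
        = (\<Sum>m\<in>{k * p}. of_nat p * (f m * cis (\<eta> / real p) ^ m))"
      using p by (intro sum.mono_neutral_cong_right) auto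
    moreover have "cis (\<eta> / real p) ^ (k * p) = cis \<eta> ^ k"
      using p by (simp add: Complex.DeMoivre)
    ultimately show ?thesis by simp
  qed
  ultimately have "(\<lambda>k. of_nat p * (f (k * p) * cis \<eta> ^ k)) sums (\<Sum>r<p. \<Sum>m. f m * cis (a r) ^ m)"
    by simp
  from sums_mult[OF this, of "1 / of_nat p"] p
  have "(\<lambda>k. f (k * p) * cis \<eta> ^ k) sums ((\<Sum>r<p. \<Sum>m. f m * cis (a r) ^ m) / of_nat p)"
    by simp
  then have "(\<Sum>k. f (k * p) * cis \<eta> ^ k) = (\<Sum>r<p. \<Sum>m. f m * cis (a r) ^ m) / of_nat p"
    by (rule sums_unique[symmetric])
  moreover have "norm (\<Sum>r<p. \<Sum>m. f m * cis (a r) ^ m) \<le> real p * C"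
    using sum_norm_le[of "{..<p}" "\<lambda>r. \<Sum>m. f m * cis (a r) ^ m" "\<lambda>_. C"] bound by simp
  then have "norm (\<Sum>r<p. \<Sum>m. f m * cis (a r) ^ m) / real p \<le> C"
    using p by (simp add: divide_le_eq mult.commute)
  ultimately show ?thesis by (simp only: norm_divide norm_of_nat)
qed

text \<open>The full series over all orders \<open>m / q\<close> is a sum of \<open>q\<close> one-sided series with starting orders \<open>r / q\<close> in
\<open>[0, 1)\<close>; the step \<open>p / q\<close> is then reached by restricting to multiples of \<open>p\<close>.\<close>

lemma rational_step_bessel_series_bounded:
  fixes p q :: nat
  assumes p: "p > 0" and q: "q > 0"
  obtains C where
    "\<And>w. w > 0 \<Longrightarrow> summable (\<lambda>k. \<bar>bessel_J (real (k * p) / real q) w\<bar>)"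
    "\<And>w \<eta>. w > 0 \<Longrightarrow> norm (\<Sum>k. of_real (bessel_J (real (k * p) / real q) w) * cis \<eta> ^ k) \<le> C"
proof -
  define f where "f w m = complex_of_real (bessel_J (real m / real q) w)" for w m
  have split: "f w (j * q + r) = of_real (bessel_J (real r / real q + real j) w)" for w j r
    using q by (simp add: f_def add_divide_distrib add.commute)
  have "\<exists>C. r < q \<longrightarrow> (\<forall>w \<psi>. w > 0 \<longrightarrow>
      norm (\<Sum>j. of_real (bessel_J (real r / real q + real j) w) * cis \<psi> ^ j) \<le> C)" for r
  proof (cases "r < q")
    case True
    then have "0 \<le> real r / real q" "real r / real q < 1" by auto
    from one_sided_bessel_series_bounded[OF this] show ?thesis by meson
  qed auto
  then have "\<exists>C. \<forall>r. r < q \<longrightarrow> (\<forall>w \<psi>. w > 0 \<longrightarrow>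
      norm (\<Sum>j. of_real (bessel_J (real r / real q + real j) w) * cis \<psi> ^ j) \<le> C r)"
    by (intro choice allI)
  then obtain C where C: "\<forall>r. r < q \<longrightarrow> (\<forall>w \<psi>. w > 0 \<longrightarrow>
      norm (\<Sum>j. of_real (bessel_J (real r / real q + real j) w) * cis \<psi> ^ j) \<le> C r)" ..
  have summ_class: "summable (\<lambda>j. norm (f w (j * q + r)))" if "w > 0" for w r
    using bessel_summable(1)[of "real r / real q" w] that by (simp add: split)
  have bound_class: "norm (\<Sum>j. f w (j * q + r) * cis (real q * \<psi>) ^ j) \<le> C r" if "w > 0" "r < q" for w r \<psi>
    using C that by (simp add: split)
  have summ: "summable (\<lambda>m. norm (f w m))" if "w > 0" for w
    by (rule norm_phase_series_le_residue_classes(1)[OF q summ_class bound_class]) (use that in auto)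
  have bound: "norm (\<Sum>m. f w m * cis \<psi> ^ m) \<le> (\<Sum>r<q. C r)" if "w > 0" for w \<psi>
    by (rule norm_phase_series_le_residue_classes(2)[OF q summ_class bound_class]) (use that in auto)
  show thesis
  proof
    fix w :: real assume w: "w > 0"
    have "summable (\<lambda>k. norm (f w (k * p)))"
    proof (rule summableI_nonneg_bounded)
      fix n
      have "(\<Sum>k<n. norm (f w (k * p))) = sum (\<lambda>m. norm (f w m)) ((\<lambda>k. k * p) ` {..<n})"
        using p by (subst sum.reindex) (auto simp: inj_on_def)
      also have "\<dots> \<le> (\<Sum>m. norm (f w m))"
        by (intro sum_le_suminf summ w) auto
      finally show "(\<Sum>k<n. norm (f w (k * p))) \<le> (\<Sum>m. norm (f w m))" .
    qed auto
    then show "summable (\<lambda>k. \<bar>bessel_J (real (k * p) / real q) w\<bar>)" by (simp add: f_def)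
    show "norm (\<Sum>k. of_real (bessel_J (real (k * p) / real q) w) * cis \<eta> ^ k) \<le> (\<Sum>r<q. C r)" for \<eta>
      using norm_phase_subseries_le[OF p summ[OF w] bound[OF w], of \<eta>] by (simp add: f_def)
  qed
qed

section \<open>Boundedness of the kernel\<close>

lemma bessel_J_0_bounded:
  obtains C where "\<And>w. w > 0 \<Longrightarrow> \<bar>bessel_J 0 w\<bar> \<le> C"
proof -
  obtain K where K0: "K \<ge> 0"
    and K: "\<And>u. u \<ge> 1 \<Longrightarrow> u * ((bessel_J (0 - 1) u)\<^sup>2 + (bessel_J 0 u)\<^sup>2) \<le> K"
    using bessel_pair_decay[OF order_refl zero_less_one] by blast
  define C where "C = exp ((1 / 2)\<^sup>2) + sqrt K"
  have "\<bar>bessel_J 0 w\<bar> \<le> C" if w: "w > 0" for w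
  proof (cases "w \<le> 1")
    case True
    have "\<bar>bessel_J (0 + real 0) w\<bar> \<le> rGamma (0 + 1) * exp ((1 / 2)\<^sup>2) * (1 / 2) powr 0 * (inverse (fact 0) * (1 / 2) ^ 0)"
      using w True by (intro bessel_J_bound) auto
    then show ?thesis using K0 by (simp add: C_def add_increasing2)
  next
    case False
    have "(bessel_J 0 w)\<^sup>2 \<le> 1 * ((bessel_J (0 - 1) w)\<^sup>2 + (bessel_J 0 w)\<^sup>2)" by simp
    also have "\<dots> \<le> w * ((bessel_J (0 - 1) w)\<^sup>2 + (bessel_J 0 w)\<^sup>2)"
      using False by (intro mult_right_mono) auto
    also have "\<dots> \<le> K" using K False by simp
    finally have "\<bar>bessel_J 0 w\<bar> \<le> sqrt K" by (metis real_sqrt_abs real_sqrt_le_mono)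
    then show ?thesis by (simp add: C_def add_increasing)
  qed
  then show thesis using that by blast
qed

theorem theorem5p4:
  fixes a :: real
  assumes "\<exists>l n :: nat. n \<ge> 1 \<and> a = 2 ^ l / real n"
  shows "\<exists>C > 0. \<forall>x y :: real ^ 2. norm (deformed_kernel a x y) \<le> C"
proof -
  obtain l n :: nat where n: "n \<ge> 1" and a: "a = 2 ^ l / real n" using assms by blast
  have a0: "a > 0" using n by (simp add: a)
  obtain C where
    summ: "\<And>w. w > 0 \<Longrightarrow> summable (\<lambda>k. \<bar>bessel_J (real (k * (2 * n)) / real (2 ^ l)) w\<bar>)" and
    C: "\<And>w \<eta>. w > 0 \<Longrightarrow>
      norm (\<Sum>k. of_real (bessel_J (real (k * (2 * n)) / real (2 ^ l)) w) * cis \<eta> ^ k) \<le> C"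
  proof -
    have "0 < 2 * n" "(0::nat) < 2 ^ l" using n by auto
    from rational_step_bessel_series_bounded[OF this] show thesis using that by blast
  qed
  obtain C0 where C0: "\<And>w. w > 0 \<Longrightarrow> \<bar>bessel_J 0 w\<bar> \<le> C0" using bessel_J_0_bounded by blast
  have order: "real (k * (2 * n)) / real (2 ^ l) = 2 * real k / a" for k
    using n by (simp add: a field_simps)
  have nonzero: "norm (deformed_kernel a x y) \<le> C + C + C0" if xy: "x \<noteq> 0" "y \<noteq> 0" for x y :: "real ^ 2"
  proof -
    define z where "z = norm x * norm y"
    define \<theta> where "\<theta> = angle x y"
    define w where "w = 2 / a * z powr (a / 2)"
    have w: "w > 0" using xy a0 by (simp add: w_def z_def)
    define S where "S \<eta> = (\<Sum>k. of_real (bessel_J (2 * real k / a) w) * cis \<eta> ^ k)" for \<eta>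
    have S: "(\<lambda>k. of_real (bessel_J (2 * real k / a) w) * cis \<eta> ^ k) sums S \<eta>" for \<eta>
      unfolding S_def
    proof (rule summable_sums[OF summable_norm_cancel])
      have "norm (of_real (bessel_J (2 * real k / a) w) * cis \<eta> ^ k)
          = \<bar>bessel_J (real (k * (2 * n)) / real (2 ^ l)) w\<bar>" for k
        by (simp only: order norm_mult norm_power norm_cis power_one mult_1_right norm_of_real)
      then show "summable (\<lambda>k. norm (complex_of_real (bessel_J (2 * real k / a) w) * cis \<eta> ^ k))"
        using summ[OF w] by (simp only:)
    qed
    have Sb: "norm (S \<eta>) \<le> C" for \<eta>
      using C[OF w, of \<eta>] by (simp only: order S_def)
    let ?t = "\<lambda>k. exp (- (\<i> * of_real pi * of_nat k / of_real a)) *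
        of_real (bessel_J (2 * real k / a) w * cos (real k * \<theta>))"
    \<comment> \<open>The phase of the kernel and the two exponentials in the cosine turn each term into one term of the
      series at \<open>\<theta> - \<pi>/a\<close> and one at \<open>-\<theta> - \<pi>/a\<close>. The index \<open>0\<close> is counted twice in this way, which explains
      the subtraction of \<open>J\<^sub>0\<close> below.\<close>
    have two_cos: "of_real (bessel_J (2 * real k / a) w) * cis (\<theta> - pi / a) ^ k
        + of_real (bessel_J (2 * real k / a) w) * cis (- \<theta> - pi / a) ^ k = 2 * ?t k" for k
    proof -
      let ?c = "cis (- (pi * real k / a))" and ?b = "complex_of_real (bessel_J (2 * real k / a) w)"
      have phase: "exp (- (\<i> * of_real pi * of_nat k / of_real a)) = ?c"
        by (simp add: cis_conv_exp mult.assoc)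
      have "real k * (\<theta> - pi / a) = - (pi * real k / a) + real k * \<theta>"
        "real k * (- \<theta> - pi / a) = - (pi * real k / a) + - (real k * \<theta>)"
        by (simp_all add: algebra_simps)
      then have pow: "cis (\<theta> - pi / a) ^ k = ?c * cis (real k * \<theta>)"
        "cis (- \<theta> - pi / a) ^ k = ?c * cis (- (real k * \<theta>))"
        by (simp_all only: Complex.DeMoivre cis_mult)
      have euler: "cis (real k * \<theta>) + cis (- (real k * \<theta>)) = 2 * of_real (cos (real k * \<theta>))"
        by (simp add: complex_eq_iff)
      have "?b * cis (\<theta> - pi / a) ^ k + ?b * cis (- \<theta> - pi / a) ^ k
          = ?b * (?c * (cis (real k * \<theta>) + cis (- (real k * \<theta>))))"
        unfolding pow by (simp only: distrib_left)
      also have "\<dots> = 2 * ?t k"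
        unfolding euler phase by (simp only: of_real_mult mult_ac)
      finally show ?thesis .
    qed
    have "(\<lambda>k. 2 * ?t k) sums (S (\<theta> - pi / a) + S (- \<theta> - pi / a))"
      using sums_add[OF S S, of "\<theta> - pi / a" "- \<theta> - pi / a"] by (simp only: two_cos)
    from sums_divide[OF this, of 2]
    have "?t sums ((S (\<theta> - pi / a) + S (- \<theta> - pi / a)) / 2)" by simp
    then have "(\<lambda>k. ?t (Suc k)) sums ((S (\<theta> - pi / a) + S (- \<theta> - pi / a)) / 2 - ?t 0)"
      by (subst sums_Suc_iff) simp
    then have "(\<Sum>k. ?t (Suc k)) = (S (\<theta> - pi / a) + S (- \<theta> - pi / a)) / 2 - ?t 0"
      by (rule sums_unique[symmetric])
    moreover have "deformed_kernel a x y = of_real (bessel_J 0 w) + 2 * (\<Sum>k. ?t (Suc k))"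
      using xy by (simp add: deformed_kernel_def Let_def w_def z_def \<theta>_def)
    ultimately have "deformed_kernel a x y = S (\<theta> - pi / a) + S (- \<theta> - pi / a) - of_real (bessel_J 0 w)"
      by simp
    also have "norm \<dots> \<le> norm (S (\<theta> - pi / a)) + norm (S (- \<theta> - pi / a)) + norm (complex_of_real (bessel_J 0 w))"
      by (intro order_trans[OF norm_triangle_ineq4] add_mono norm_triangle_ineq order_refl)
    also have "\<dots> \<le> C + C + C0"
      using Sb C0[OF w] by (intro add_mono) auto
    finally show ?thesis .
  qed
  have "norm (deformed_kernel a x y) \<le> max 1 (C + C + C0)" for x y :: "real ^ 2"
    using nonzero[of x y] by (cases "x = 0 \<or> y = 0") (auto simp: deformed_kernel_def)
  then show ?thesis by (intro exI[of _ "max 1 (C + C + C0)"]) auto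
qed

end
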